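(* Let $\mathbb F$ be an algebraically closed field and let $A=\sigma(\mathbb F)\langle x_1,\dots,x_n\rangle$ be a quasi-commutative bijective skew PBW extension of $\mathbb F$. Assume that the center $Z(A)$ is a polynomial ring in $n$ variables over $\mathbb F$, i.e. $Z(A)=\mathbb F[y_1,\dots,y_n]$ for some algebraically independent elements $y_1,\dots,y_n\in Z(A)$. Let $I$ be a two-sided ideal of $A$ and put $J:=I\cap Z(A)$ (the preimage of $I$ under the inclusion $Z(A)\hookrightarrow A$). Then $$\big\langle I_{Z(A)}(V_{Z(A)}(J))\big\rangle\subseteq\sqrt{I}\subseteq I(V(I)),$$ where $\langle\,\cdot\,\rangle$ denotes the two-sided ideal of $A$ generated by a subset.
   Context: Skew PBW extension: a ring $A$ is a skew PBW extension of a ring $R$, written $A=\sigma(R)\langle x_1,\dots,x_n\rangle$, if (1) $R\subseteq A$ is a subring; (2) there are $x_1,\dots,x_n\in A$ such that $A$ is a free left $R$-module with basis $\mathrm{Mon}(A)=\{x_1^{\alpha_1}\cdots x_n^{\alpha_n}:\alpha\in\mathbb N^n\}$; (3) for every $i$ and every $r\in R\setminus\{0\}$ there is $c_{i,r}\in R\setminus\{0\}$ with $x_ir-c_{i,r}x_i\in R$; (4) for every $i,j$ there is $c_{i,j}\in R\setminus\{0\}$ with $x_jx_i-c_{i,j}x_ix_j\in R+Rx_1+\cdots+Rx_n$. For each $i$ there are then an injective ring endomorphism $\sigma_i$ of $R$ and a $\sigma_i$-derivation $\delta_i$ with $x_ir=\sigma_i(r)x_i+\delta_i(r)$. $A$ is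 bijective if every $\sigma_i$ is bijective and every $c_{i,j}$ is invertible. $A$ is quasi-commutative if (3),(4) are replaced by: $x_ir=c_{i,r}x_i$ for some $c_{i,r}\in R\setminus\{0\}$, and $x_jx_i=c_{i,j}x_ix_j$ for some $c_{i,j}\in R\setminus\{0\}$. Roots, vanishing sets, ideals of points in $A$: for $Z=(z_1,\dots,z_n)\in\mathbb F^n$, $\langle Z\rangle$ is the two-sided ideal of $A$ generated by $x_1-z_1,\dots,x_n-z_n$; $f\in A$ has root $Z$ iff $f\in\langle Z\rangle$. $V(I)=\{Z\in\mathbb F^n: f\in\langle Z\rangle\ \forall f\in I\}$ and, for $X\subseteq\mathbb F^n$, $I(X)=\{g\in A: g\in\langle Z\rangle\ \forall Z\in X\}$. In the commutative polynomial ring $Z(A)=\mathbb F[y_1,\dots,y_n]$: $V_{Z(A)}(J)=\{a\in\mathbb F^n: g(a)=0\ \forall g\in J\}$ (classical evaluation, equivalently $g$ lies in the ideal generated by $y_1-a_1,\dots,y_n-a_n$), and for $X\subseteq\mathbb F^n$, $I_{Z(A)}(X)=\{g\in Z(A): g(a)=0\ \forall a\in X\}$. Radical: a proper two-sided ideal $P$ of a ring $S$ is prime if for all left ideals $L,K$ of $S$, $LK\subseteq P$ implies $L\subseteq P$ or $K\subseteq P$. For a two-sided ideal $I$ of $A$, $\sqrt{I}$ is the intersection of all prime ideals of $A$ containing $I$ (with $\sqrt{A}=A$). *)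

theory Defs
  imports "HOL-Algebra.Algebra" "HOL-Algebra.Algebraic_Closure"
begin

definition exps :: "nat \<Rightarrow> (nat \<Rightarrow> nat) set" where
  "exps n = {\<alpha>. \<forall>i\<ge>n. \<alpha> i = 0}"

definition points :: "('a, 'b) ring_scheme \<Rightarrow> 'a set \<Rightarrow> nat \<Rightarrow> (nat \<Rightarrow> 'a) set" where
  "points A K n = {z. (\<forall>i<n. z i \<in> K) \<and> (\<forall>i\<ge>n. z i = \<zero>\<^bsub>A\<^esub>)}"

definition mon :: "('a, 'b) ring_scheme \<Rightarrow> (nat \<Rightarrow> 'a) \<Rightarrow> nat \<Rightarrow> (nat \<Rightarrow> nat) \<Rightarrow> 'a" where
  "mon A x n \<alpha> = foldr (\<lambda>i acc. (x i [^]\<^bsub>A\<^esub> (\<alpha> i)) \<otimes>\<^bsub>A\<^esub> acc) [0..<n] \<one>\<^bsub>A\<^esub>"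

definition coeffs :: "('a, 'b) ring_scheme \<Rightarrow> 'a set \<Rightarrow> nat \<Rightarrow> ((nat \<Rightarrow> nat) \<Rightarrow> 'a) set" where
  "coeffs A K n = {c. (\<forall>\<alpha>. c \<alpha> \<in> K) \<and> finite {\<alpha>. c \<alpha> \<noteq> \<zero>\<^bsub>A\<^esub>}
                      \<and> (\<forall>\<alpha>. \<alpha> \<notin> exps n \<longrightarrow> c \<alpha> = \<zero>\<^bsub>A\<^esub>)}"

definition lin_comb :: "('a, 'b) ring_scheme \<Rightarrow> (nat \<Rightarrow> 'a) \<Rightarrow> nat \<Rightarrow> ((nat \<Rightarrow> nat) \<Rightarrow> 'a) \<Rightarrow> 'a" where
  "lin_comb A x n c = (\<Oplus>\<^bsub>A\<^esub> \<alpha> \<in> {\<alpha>. c \<alpha> \<noteq> \<zero>\<^bsub>A\<^esub>}. c \<alpha> \<otimes>\<^bsub>A\<^esub> mon A x n \<alpha>)"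

definition skew_PBW :: "('a, 'b) ring_scheme \<Rightarrow> 'a set \<Rightarrow> (nat \<Rightarrow> 'a) \<Rightarrow> nat \<Rightarrow> bool" where
  "skew_PBW A K x n \<longleftrightarrow>
     ring A \<and> subring K A \<and> (\<forall>i<n. x i \<in> carrier A) \<and>
     bij_betw (lin_comb A x n) (coeffs A K n) (carrier A) \<and>
     (\<forall>i<n. \<forall>r\<in>K - {\<zero>\<^bsub>A\<^esub>}. \<exists>c\<in>K - {\<zero>\<^bsub>A\<^esub>}.
        x i \<otimes>\<^bsub>A\<^esub> r \<ominus>\<^bsub>A\<^esub> c \<otimes>\<^bsub>A\<^esub> x i \<in> K) \<and>
     (\<forall>i<n. \<forall>j<n. \<exists>c\<in>K - {\<zero>\<^bsub>A\<^esub>}.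
        x j \<otimes>\<^bsub>A\<^esub> x i \<ominus>\<^bsub>A\<^esub> c \<otimes>\<^bsub>A\<^esub> x i \<otimes>\<^bsub>A\<^esub> x j
          \<in> {lin_comb A x n d | d. d \<in> coeffs A K n \<and> (\<forall>\<alpha>. sum \<alpha> {..<n} > 1 \<longrightarrow> d \<alpha> = \<zero>\<^bsub>A\<^esub>)})"

definition quasi_commutative :: "('a, 'b) ring_scheme \<Rightarrow> 'a set \<Rightarrow> (nat \<Rightarrow> 'a) \<Rightarrow> nat \<Rightarrow> bool" where
  "quasi_commutative A K x n \<longleftrightarrow>
     (\<forall>i<n. \<forall>r\<in>K - {\<zero>\<^bsub>A\<^esub>}. \<exists>c\<in>K - {\<zero>\<^bsub>A\<^esub>}. x i \<otimes>\<^bsub>A\<^esub> r = c \<otimes>\<^bsub>A\<^esub> x i) \<and>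
     (\<forall>i<n. \<forall>j<n. \<exists>c\<in>K - {\<zero>\<^bsub>A\<^esub>}. x j \<otimes>\<^bsub>A\<^esub> x i = c \<otimes>\<^bsub>A\<^esub> x i \<otimes>\<^bsub>A\<^esub> x j)"

definition bijective_PBW :: "('a, 'b) ring_scheme \<Rightarrow> 'a set \<Rightarrow> (nat \<Rightarrow> 'a) \<Rightarrow> nat \<Rightarrow> bool" where
  "bijective_PBW A K x n \<longleftrightarrow>
     (\<forall>i<n. \<exists>\<sigma> \<delta>. (\<forall>r\<in>K. \<sigma> r \<in> K \<and> \<delta> r \<in> K \<and>
                           x i \<otimes>\<^bsub>A\<^esub> r = \<sigma> r \<otimes>\<^bsub>A\<^esub> x i \<oplus>\<^bsub>A\<^esub> \<delta> r)
                   \<and> bij_betw \<sigma> K K) \<and>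
     (\<forall>i<n. \<forall>j<n. \<forall>c\<in>K - {\<zero>\<^bsub>A\<^esub>}.
        x j \<otimes>\<^bsub>A\<^esub> x i \<ominus>\<^bsub>A\<^esub> c \<otimes>\<^bsub>A\<^esub> x i \<otimes>\<^bsub>A\<^esub> x j
          \<in> {lin_comb A x n d | d. d \<in> coeffs A K n \<and> (\<forall>\<alpha>. sum \<alpha> {..<n} > 1 \<longrightarrow> d \<alpha> = \<zero>\<^bsub>A\<^esub>)}
        \<longrightarrow> c \<in> Units (A\<lparr>carrier := K\<rparr>))"

definition ring_center :: "('a, 'b) ring_scheme \<Rightarrow> 'a set" where
  "ring_center A = {a \<in> carrier A. \<forall>b\<in>carrier A. a \<otimes>\<^bsub>A\<^esub> b = b \<otimes>\<^bsub>A\<^esub> a}"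

text \<open>Z(A) = F[y_1..y_n] with y algebraically independent: the map from polynomials
  (coefficient families) sum c_alpha y^alpha into Z(A) is a bijection.\<close>
definition center_poly_ring :: "('a, 'b) ring_scheme \<Rightarrow> 'a set \<Rightarrow> (nat \<Rightarrow> 'a) \<Rightarrow> nat \<Rightarrow> bool" where
  "center_poly_ring A K y n \<longleftrightarrow>
     (\<forall>i<n. y i \<in> ring_center A) \<and> bij_betw (lin_comb A y n) (coeffs A K n) (ring_center A)"

definition evalZ :: "('a, 'b) ring_scheme \<Rightarrow> 'a set \<Rightarrow> (nat \<Rightarrow> 'a) \<Rightarrow> nat \<Rightarrow> 'a \<Rightarrow> (nat \<Rightarrow> 'a) \<Rightarrow> 'a" where
  "evalZ A K y n g a = lin_comb A a n (THE c. c \<in> coeffs A K n \<and> lin_comb A y n c = g)"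

definition VZ :: "('a, 'b) ring_scheme \<Rightarrow> 'a set \<Rightarrow> (nat \<Rightarrow> 'a) \<Rightarrow> nat \<Rightarrow> 'a set \<Rightarrow> (nat \<Rightarrow> 'a) set" where
  "VZ A K y n J = {a \<in> points A K n. \<forall>g\<in>J. evalZ A K y n g a = \<zero>\<^bsub>A\<^esub>}"

definition IZ :: "('a, 'b) ring_scheme \<Rightarrow> 'a set \<Rightarrow> (nat \<Rightarrow> 'a) \<Rightarrow> nat \<Rightarrow> (nat \<Rightarrow> 'a) set \<Rightarrow> 'a set" where
  "IZ A K y n S = {g \<in> ring_center A. \<forall>a\<in>S. evalZ A K y n g a = \<zero>\<^bsub>A\<^esub>}"

definition pt_ideal :: "('a, 'b) ring_scheme \<Rightarrow> (nat \<Rightarrow> 'a) \<Rightarrow> nat \<Rightarrow> (nat \<Rightarrow> 'a) \<Rightarrow> 'a set" where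
  "pt_ideal A x n z = genideal A {x i \<ominus>\<^bsub>A\<^esub> z i | i. i < n}"

definition V :: "('a, 'b) ring_scheme \<Rightarrow> 'a set \<Rightarrow> (nat \<Rightarrow> 'a) \<Rightarrow> nat \<Rightarrow> 'a set \<Rightarrow> (nat \<Rightarrow> 'a) set" where
  "V A K x n I = {z \<in> points A K n. \<forall>f\<in>I. f \<in> pt_ideal A x n z}"

definition Iv :: "('a, 'b) ring_scheme \<Rightarrow> (nat \<Rightarrow> 'a) \<Rightarrow> nat \<Rightarrow> (nat \<Rightarrow> 'a) set \<Rightarrow> 'a set" where
  "Iv A x n S = {g \<in> carrier A. \<forall>z\<in>S. g \<in> pt_ideal A x n z}"

definition left_ideal :: "'a set \<Rightarrow> ('a, 'b) ring_scheme \<Rightarrow> bool" where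
  "left_ideal L A \<longleftrightarrow> additive_subgroup L A \<and> (\<forall>a\<in>carrier A. \<forall>l\<in>L. a \<otimes>\<^bsub>A\<^esub> l \<in> L)"

definition ideal_mult :: "('a, 'b) ring_scheme \<Rightarrow> 'a set \<Rightarrow> 'a set \<Rightarrow> 'a set" where
  "ideal_mult A L K = \<Inter>{H. additive_subgroup H A \<and> {l \<otimes>\<^bsub>A\<^esub> k | l k. l \<in> L \<and> k \<in> K} \<subseteq> H}"

definition prime_ideal_nc :: "'a set \<Rightarrow> ('a, 'b) ring_scheme \<Rightarrow> bool" where
  "prime_ideal_nc P A \<longleftrightarrow> ideal P A \<and> P \<noteq> carrier A \<and>
     (\<forall>L K. left_ideal L A \<longrightarrow> left_ideal K A \<longrightarrow> ideal_mult A L K \<subseteq> P \<longrightarrow> L \<subseteq> P \<or> K \<subseteq> P)"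

text \<open>Radical: intersection of all prime ideals containing I (equal to A if there are none).\<close>
definition radical :: "('a, 'b) ring_scheme \<Rightarrow> 'a set \<Rightarrow> 'a set" where
  "radical A I = carrier A \<inter> \<Inter>{P. prime_ideal_nc P A \<and> I \<subseteq> P}"

end

theory Submission
  imports Defs
begin

text \<open>
  The right inclusion: modulo \<open>\<langle>Z\<rangle>\<close> every monomial becomes a scalar, so
  \<open>A = K + \<langle>Z\<rangle>\<close>, and \<open>\<langle>Z\<rangle>\<close> is either \<open>A\<close> or a prime ideal.
  The left inclusion: by Hilbert's Nullstellensatz in the center, every \<open>g\<close> vanishing on the zeros
  of \<open>J\<close> has a power in \<open>J\<close>, and a central element with a power in a prime ideal lies in it.

  For the Nullstellensatz, suppose that no power of \<open>g\<close> lies in \<open>J\<close> and choose a prime ideal \<open>P \<supseteq> J\<close>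
  with \<open>g \<notin> P\<close>. In the domain \<open>Z(A) / P\<close>, adjoin the generators one at a time: for a subring \<open>S\<close> and
  \<open>0 \<noteq> v \<in> S[x]\<close> there is \<open>0 \<noteq> u \<in> S\<close> such that each homomorphism \<open>S \<rightarrow> K\<close> not killing \<open>u\<close>
  extends to one on \<open>S[x]\<close> not killing \<open>v\<close>. This gives a \<open>K\<close>-homomorphism \<open>Z(A) / P \<rightarrow> K\<close> not killing \<open>g\<close>,
  that is, a zero of \<open>J\<close> at which \<open>g\<close> does not vanish.
\<close>

section \<open>Roots and non-roots of univariate polynomials over an algebraically closed
  field\<close>

text \<open>List polynomials start with the leading coefficient, hence the \<open>rev\<close>. The
  sum on the right is also what \<open>UnivPoly.eval\<close> unfolds to, so it links the two
  representations of polynomials.\<close>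

lemma (in ring) eval_map_rev_upt:
  assumes "\<And>i. c i \<in> carrier R" and "a \<in> carrier R"
  shows "eval (map c (rev [0..<m])) a = (\<Oplus>i\<in>{..<m}. c i \<otimes> a [^] i)"
proof (induction m)
  case (Suc m)
  then show ?case
    using assms by (simp add: lessThan_Suc)
qed simp

text \<open>A polynomial that splits has as many roots as its degree, so positive degree provides
  one.\<close>

lemma (in algebraically_closed) ex_root:
  fixes c :: "nat \<Rightarrow> _"
  assumes c: "\<And>i. c i \<in> carrier L" and "c d \<noteq> \<zero>" and "d > 0"
  shows "\<exists>a\<in>carrier L. (\<Oplus>i\<in>{..d}. c i \<otimes> a [^] i) = \<zero>"
proof -
  define p where "p = map c (rev [0..<Suc d])"
  have p: "p \<in> carrier (poly_ring L)"
    unfolding univ_poly_carrier[symmetric] polynomial_def p_def using c \<open>c d \<noteq> \<zero>\<close> by auto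
  have "degree p = d"
    by (simp add: p_def)
  with roots_over_carrier[OF p] \<open>d > 0\<close> have "roots p \<noteq> {#}"
    unfolding splitted_def by auto
  then obtain a where "a \<in># roots p"
    by blast
  then have "is_root p a"
    using roots_mem_iff_is_root[OF p] by blast
  then have a: "a \<in> carrier L" "eval p a = \<zero>"
    unfolding is_root_def by auto
  then show ?thesis
    using eval_map_rev_upt[where c = c and m = "Suc d", OF c a(1)] by (auto simp: p_def lessThan_Suc_atMost)
qed

lemma (in algebraically_closed) ex_nonroot:
  fixes c :: "nat \<Rightarrow> _"
  assumes c: "\<And>i. c i \<in> carrier L" and "c d \<noteq> \<zero>"
  shows "\<exists>a\<in>carrier L. (\<Oplus>i\<in>{..d}. c i \<otimes> a [^] i) \<noteq> \<zero>"
proof (cases "d > 0")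
  case False
  \<comment> \<open>For \<open>d = 0\<close> the sum is the constant \<open>c 0\<close>, so every
    point is a non-root.\<close>
  then show ?thesis
    using assms by (intro bexI[of _ \<zero>]) (auto simp: atMost_0)
next
  case True
  text \<open>A root of the polynomial minus 1 is not a root of the polynomial.\<close>
  define c' where "c' i = (if i = 0 then c 0 \<ominus> \<one> else c i)" for i
  have c': "c' i \<in> carrier L" for i
    using c by (auto simp: c'_def)
  obtain a where a: "a \<in> carrier L" and 0: "(\<Oplus>i\<in>{..d}. c' i \<otimes> a [^] i) = \<zero>"
    using ex_root[of c' d] c' True \<open>c d \<noteq> \<zero>\<close> by (auto simp: c'_def)
  \<comment> \<open>The families \<open>c\<close> and \<open>c'\<close> differ only at 0, so the
    constant term is separated from the common rest.\<close>
  have split: "{..d} = insert 0 {0<..d}"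
    by auto
  have eq: "(\<Oplus>i\<in>{0<..d}. c' i \<otimes> a [^] i) = (\<Oplus>i\<in>{0<..d}. c i \<otimes> a [^] i)"
    using c a by (intro finsum_cong') (auto simp: c'_def)
  let ?s = "\<Oplus>i\<in>{0<..d}. c i \<otimes> a [^] i"
  have s: "?s \<in> carrier L"
    using c a by (intro finsum_closed) auto
  have "c' 0 \<oplus> ?s = \<zero>"
    using 0 c c' a unfolding split by (subst (asm) finsum_insert) (auto simp: eq)
  moreover have "c 0 = c' 0 \<oplus> \<one>"
    using c by (simp add: c'_def minus_eq a_assoc l_neg)
  moreover have "c' 0 \<oplus> \<one> \<oplus> ?s = (c' 0 \<oplus> ?s) \<oplus> \<one>"
    using c' s by (simp add: a_ac)
  ultimately have "c 0 \<oplus> ?s = \<one>"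
    by simp
  moreover have "(\<Oplus>i\<in>{..d}. c i \<otimes> a [^] i) = c 0 \<oplus> ?s"
    using c a unfolding split by (subst finsum_insert) auto
  ultimately show ?thesis
    using a by (intro bexI[of _ a]) auto
qed

section \<open>Extending homomorphisms to a ring with one more generator\<close>

text \<open>Any preimage under \<open>e\<close> can be used to define \<open>h\<close>: two of them
  differ by an element of the kernel of \<open>e\<close>, which \<open>g\<close> kills.\<close>

lemma ring_hom_factor_image:
  assumes "ring T" and "ring B" and "ring F"
    and e: "e \<in> ring_hom T B" and g: "g \<in> ring_hom T F"
    and ker: "\<And>p. p \<in> carrier T \<Longrightarrow> e p = \<zero>\<^bsub>B\<^esub> \<Longrightarrow> g p = \<zero>\<^bsub>F\<^esub>"
  obtains h where "h \<in> ring_hom (B\<lparr>carrier := e ` carrier T\<rparr>) F"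
    and "\<And>p. p \<in> carrier T \<Longrightarrow> h (e p) = g p"
proof -
  interpret T: ring T by fact
  interpret F: ring F by fact
  interpret e: ring_hom_ring T B e
    using assms by (intro ring_hom_ringI2)
  interpret g: ring_hom_ring T F g
    using assms by (intro ring_hom_ringI2)
  define h where "h y = g (SOME p. p \<in> carrier T \<and> e p = y)" for y
  have h: "h (e p) = g p" if p: "p \<in> carrier T" for p
  proof -
    define q where "q = (SOME q. q \<in> carrier T \<and> e q = e p)"
    have q: "q \<in> carrier T" "e q = e p"
      using someI[of "\<lambda>q. q \<in> carrier T \<and> e q = e p" p] p by (auto simp: q_def)
    then have "e (q \<ominus>\<^bsub>T\<^esub> p) = \<zero>\<^bsub>B\<^esub>"
      using p by (simp add: T.minus_eq e.S.r_neg)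
    then have "g (q \<ominus>\<^bsub>T\<^esub> p) = \<zero>\<^bsub>F\<^esub>"
      using p q by (intro ker) auto
    then have "g q = g p"
      using p q by (metis F.r_right_minus_eq T.minus_eq g.hom_a_inv g.hom_add g.hom_closed T.a_inv_closed F.minus_eq)
    then show ?thesis
      by (simp add: h_def q_def)
  qed
  moreover have "h \<in> ring_hom (B\<lparr>carrier := e ` carrier T\<rparr>) F"
  proof (rule ring_hom_memI)
    show "h \<one>\<^bsub>B\<lparr>carrier := e ` carrier T\<rparr>\<^esub> = \<one>\<^bsub>F\<^esub>"
      using h[of "\<one>\<^bsub>T\<^esub>"] by simp
  qed (auto simp: h simp flip: e.hom_mult e.hom_add)
  ultimately show thesis
    by (rule that[rotated])
qed

lemma (in UP_pre_univ_prop) eval_smult: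
  assumes "s \<in> carrier S" and "r \<in> carrier R" and "p \<in> carrier P"
  shows "UnivPoly.eval R S h s (r \<odot>\<^bsub>P\<^esub> p) = h r \<otimes>\<^bsub>S\<^esub> UnivPoly.eval R S h s p"
  using assms ring_hom_mult[OF eval_ring_hom[OF assms(1)], of "UnivPoly.monom P r 0" p]
  by (simp add: eval_const flip: monom_mult_is_smult)

text \<open>The ring S[x] is realized inside \<open>D\<close> as the image \<open>adj\<close> of the
  polynomial ring \<open>U\<close> over \<open>S\<close> under evaluation \<open>ev\<close> at
  \<open>x\<close>. The kernel of \<open>ev\<close> is trivial exactly when \<open>x\<close> is
  transcendental over \<open>S\<close>.\<close>

locale adjoin_element = domain D for D (structure) +
  fixes S :: "'a set" and x :: 'a
  assumes subring: "subring S D" and x_closed: "x \<in> carrier D"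
begin

abbreviation "R0 \<equiv> D\<lparr>carrier := S\<rparr>"
abbreviation "U \<equiv> UP R0"
abbreviation "ev \<equiv> UnivPoly.eval R0 D id x"
abbreviation "adj \<equiv> ev ` carrier U"

sublocale R0: domain R0
  using subring by (rule subring_is_domain)

sublocale U: UP_domain R0 U
  using R0.domain_axioms by (simp add: UP_domain_def)

sublocale id: UP_pre_univ_prop R0 D id U
  using subringE(1)[OF subring] by unfold_locales (auto intro!: ring_hom_memI)

sublocale ev: ring_hom_cring U D ev
  using id.eval_ring_hom[OF x_closed] U.P.cring_axioms is_cring by (intro ring_hom_cringI)

lemma ev_const: "s \<in> S \<Longrightarrow> ev (UnivPoly.monom U s 0) = s"
  using id.eval_const[OF x_closed, of s] by simp

lemma ev_smult: "s \<in> S \<Longrightarrow> p \<in> carrier U \<Longrightarrow> ev (s \<odot>\<^bsub>U\<^esub> p) = s \<otimes> ev p"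
  using id.eval_smult[OF x_closed, of s p] by simp

text \<open>Sending \<open>x\<close> to \<open>a\<close> always defines a homomorphism on
  polynomials; \<open>ker\<close> is what lets it factor through \<open>ev\<close>.\<close>

lemma ex_hom_adj:
  assumes "cring F" and h: "h \<in> ring_hom R0 F" and a: "a \<in> carrier F"
    and ker: "\<And>p. p \<in> carrier U \<Longrightarrow> ev p = \<zero> \<Longrightarrow> UnivPoly.eval R0 F h a p = \<zero>\<^bsub>F\<^esub>"
  obtains h' where "h' \<in> ring_hom (D\<lparr>carrier := adj\<rparr>) F"
    and "\<And>p. p \<in> carrier U \<Longrightarrow> h' (ev p) = UnivPoly.eval R0 F h a p"
    and "\<And>s. s \<in> S \<Longrightarrow> h' s = h s"
proof -
  interpret F: cring F by fact
  interpret UP_pre_univ_prop R0 F h U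
    using h by unfold_locales
  obtain h' where h': "h' \<in> ring_hom (D\<lparr>carrier := adj\<rparr>) F"
    "\<And>p. p \<in> carrier U \<Longrightarrow> h' (ev p) = UnivPoly.eval R0 F h a p"
    using ring_hom_factor_image[OF U.P.ring_axioms ring_axioms F.ring_axioms ev.homh eval_ring_hom[OF a] ker]
    by blast
  have "h' s = h s" if "s \<in> S" for s
    using h'(2)[of "UnivPoly.monom U s 0"] that by (simp add: ev_const eval_const[OF a])
  with h' show thesis
    by (rule that)
qed

text \<open>Pseudo-division: \<open>S\<close> need not be a field, so \<open>f\<close> is first
  multiplied by a power of the leading coefficient of \<open>g\<close>. The shape of
  \<open>b\<close> is recorded because a homomorphism into a field that does not kill the leading
  coefficient does not kill \<open>b\<close> either.\<close>

lemma ev_long_div: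
  assumes g: "g \<in> carrier U" "g \<noteq> \<zero>\<^bsub>U\<^esub>" and f: "f \<in> carrier U"
  obtains b q r and k :: nat where "b = U.lcoeff g [^]\<^bsub>R0\<^esub> k" and "b \<in> S" and "b \<noteq> \<zero>"
    and "q \<in> carrier U" and "r \<in> carrier U"
    and "b \<odot>\<^bsub>U\<^esub> f = g \<otimes>\<^bsub>U\<^esub> q \<oplus>\<^bsub>U\<^esub> r" and "b \<otimes> ev f = ev g \<otimes> ev q \<oplus> ev r"
    and "r = \<zero>\<^bsub>U\<^esub> \<or> deg R0 r < deg R0 g"
proof -
  obtain q r and k :: nat where *: "q \<in> carrier U" "r \<in> carrier U"
    "U.lcoeff g [^]\<^bsub>R0\<^esub> k \<odot>\<^bsub>U\<^esub> f = g \<otimes>\<^bsub>U\<^esub> q \<oplus>\<^bsub>U\<^esub> r" "r = \<zero>\<^bsub>U\<^esub> \<or> deg R0 r < deg R0 g"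
    using U.long_div_theorem[OF g(1) f g(2)] by blast
  define b where "b = U.lcoeff g [^]\<^bsub>R0\<^esub> k"
  have l: "U.lcoeff g \<in> carrier R0" "U.lcoeff g \<noteq> \<zero>\<^bsub>R0\<^esub>"
    using U.lcoeff_closed[OF g(1)] U.lcoeff_nonzero[OF g(2,1)] by auto
  have "b \<in> carrier R0"
    unfolding b_def using l by (intro R0.nat_pow_closed)
  then have bS: "b \<in> S"
    by simp
  have "U.lcoeff g [^]\<^bsub>R0\<^esub> k \<noteq> \<zero>\<^bsub>R0\<^esub>"
  proof (induction k)
    case (Suc k)
    then show ?case
      using l R0.integral[of "U.lcoeff g [^]\<^bsub>R0\<^esub> k" "U.lcoeff g"] R0.nat_pow_closed[OF l(1), of k] by fastforce
  qed (use R0.one_not_zero in simp)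
  then have b0: "b \<noteq> \<zero>"
    by (simp add: b_def)
  have eq: "b \<odot>\<^bsub>U\<^esub> f = g \<otimes>\<^bsub>U\<^esub> q \<oplus>\<^bsub>U\<^esub> r"
    using * by (simp add: b_def)
  have "b \<otimes> ev f = ev (b \<odot>\<^bsub>U\<^esub> f)"
    using ev_smult bS f by simp
  also have "\<dots> = ev g \<otimes> ev q \<oplus> ev r"
    unfolding eq using * g by simp
  finally show thesis
    using that[of b k q r] b_def bS b0 * eq by blast
qed

text \<open>Among the polynomials whose value at \<open>x\<close> is a nonzero multiple of \<open>v\<close>, one of minimal degree is
  constant: otherwise, dividing the minimal polynomial \<open>P\<close> by it would yield a remainder or a quotient
  that contradicts one of the two minimalities.\<close>

lemma algebraic_multiple:
  assumes P: "P \<in> carrier U" "P \<noteq> \<zero>\<^bsub>U\<^esub>" "ev P = \<zero>"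
    and min: "\<And>p. p \<in> carrier U \<Longrightarrow> ev p = \<zero> \<Longrightarrow> p \<noteq> \<zero>\<^bsub>U\<^esub> \<Longrightarrow> deg R0 P \<le> deg R0 p"
    and v: "v \<in> adj" "v \<noteq> \<zero>"
  shows "\<exists>u\<in>S. u \<noteq> \<zero> \<and> (\<exists>t\<in>adj. u = t \<otimes> v)"
proof -
  define good where "good p \<longleftrightarrow> p \<in> carrier U \<and> ev p \<noteq> \<zero> \<and> (\<exists>t\<in>carrier U. ev p = ev t \<otimes> v)" for p
  have vD: "v \<in> carrier D"
    using v by auto
  obtain p0 where "p0 \<in> carrier U" "ev p0 = v"
    using v by auto
  then have "good p0"
    using v vD by (auto simp: good_def intro!: bexI[of _ "\<one>\<^bsub>U\<^esub>"])
  then obtain w where "good w" and w_min: "\<And>p. good p \<Longrightarrow> deg R0 w \<le> deg R0 p"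
    using ex_has_least_nat[of good p0 "deg R0"] by blast
  then obtain t where w: "w \<in> carrier U" "ev w \<noteq> \<zero>" and t: "t \<in> carrier U" "ev w = ev t \<otimes> v"
    by (auto simp: good_def)
  have w0: "w \<noteq> \<zero>\<^bsub>U\<^esub>"
    using w by auto
  \<comment> \<open>As \<open>ev P = \<zero>\<close>, the remainder of \<open>w\<close> modulo
    \<open>P\<close> has the value \<open>b \<otimes> ev w\<close>, again a nonzero multiple of
    \<open>v\<close>. So its degree is at least that of \<open>w\<close>, and it is below that of
    \<open>P\<close>.\<close>
  have "deg R0 w < deg R0 P"
  proof -
    obtain b q r where b: "b \<in> S" "b \<noteq> \<zero>" "q \<in> carrier U" "r \<in> carrier U" "b \<otimes> ev w = ev P \<otimes> ev q \<oplus> ev r"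
      "r = \<zero>\<^bsub>U\<^esub> \<or> deg R0 r < deg R0 P"
      using ev_long_div[OF P(1,2) w(1)] by blast
    have D: "b \<in> carrier D"
      using b subringE(1)[OF subring] by auto
    have "ev r = b \<otimes> ev w"
      using b D P(3) w by simp
    also have "\<dots> = ev (b \<odot>\<^bsub>U\<^esub> t) \<otimes> v"
      using b(1) D t vD by (simp add: ev_smult m_assoc)
    finally have "ev r = ev (b \<odot>\<^bsub>U\<^esub> t) \<otimes> v" .
    moreover have "ev r \<noteq> \<zero>"
      unfolding \<open>ev r = b \<otimes> ev w\<close> using integral[of b "ev w"] b(2) D w by blast
    moreover have "b \<odot>\<^bsub>U\<^esub> t \<in> carrier U"
      using b(1) t(1) by (intro U.UP_smult_closed) auto
    ultimately have "good r"
      unfolding good_def using b(4) by blast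
    then have "r \<noteq> \<zero>\<^bsub>U\<^esub>"
      by (auto simp: good_def)
    with w_min[OF \<open>good r\<close>] b(6) show ?thesis
      by linarith
  qed
  have "deg R0 w = 0"
  proof (rule ccontr)
    assume pos: "deg R0 w \<noteq> 0"
    obtain b q r where b: "b \<in> S" "b \<noteq> \<zero>" "q \<in> carrier U" "r \<in> carrier U" "b \<otimes> ev P = ev w \<otimes> ev q \<oplus> ev r"
      "r = \<zero>\<^bsub>U\<^esub> \<or> deg R0 r < deg R0 w" and eq: "b \<odot>\<^bsub>U\<^esub> P = w \<otimes>\<^bsub>U\<^esub> q \<oplus>\<^bsub>U\<^esub> r"
      using ev_long_div[OF w(1) w0 P(1)] by blast
    have D: "b \<in> carrier D"
      using b subringE(1)[OF subring] by auto
    have "ev r = \<ominus> (ev w \<otimes> ev q)"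
      using b D P(3) w by (simp add: minus_equality a_comm)
    also have "\<dots> = ev (\<ominus>\<^bsub>U\<^esub> (t \<otimes>\<^bsub>U\<^esub> q)) \<otimes> v"
      using b t vD by (simp add: l_minus r_minus m_ac)
    finally have "good r" if "ev r \<noteq> \<zero>"
      using that b(4) U.UP_a_inv_closed[OF U.UP_mult_closed[OF t(1) b(3)]] unfolding good_def by blast
    then have "ev r = \<zero>"
      using w_min[of r] b(6) by (cases "r = \<zero>\<^bsub>U\<^esub>") auto
    \<comment> \<open>The remainder has value zero and degree below that of \<open>w\<close>, hence
      below that of \<open>P\<close>, the minimal degree in the kernel of \<open>ev\<close>.\<close>
    then have r: "r = \<zero>\<^bsub>U\<^esub>"
      using min[OF b(4)] b(6) \<open>deg R0 w < deg R0 P\<close> by linarith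
    have "ev q = \<zero>"
      using b D P(3) w \<open>ev r = \<zero>\<close> integral[of "ev w" "ev q"] by simp
    have bm: "UnivPoly.monom U b 0 \<noteq> \<zero>\<^bsub>U\<^esub>" "UnivPoly.monom U b 0 \<in> carrier U"
      using b ev_const[of b] by auto
    have wq: "b \<odot>\<^bsub>U\<^esub> P = w \<otimes>\<^bsub>U\<^esub> q"
      using eq r w b by simp
    moreover have "b \<odot>\<^bsub>U\<^esub> P \<noteq> \<zero>\<^bsub>U\<^esub>"
      using U.UP_integral[OF _ bm(2) P(1)] bm P b U.monom_mult_is_smult[of b P] by auto
    ultimately have "q \<noteq> \<zero>\<^bsub>U\<^esub>"
      using w by auto
    then have "deg R0 (b \<odot>\<^bsub>U\<^esub> P) = deg R0 w + deg R0 q"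
      unfolding wq using w w0 b by (intro U.deg_mult) auto
    moreover have "deg R0 (b \<odot>\<^bsub>U\<^esub> P) = deg R0 P"
      using U.deg_smult[of b P] b P by simp
    ultimately show False
      using min[OF b(3) \<open>ev q = \<zero>\<close> \<open>q \<noteq> \<zero>\<^bsub>U\<^esub>\<close>] pos by simp
  qed
  then have "w = UnivPoly.monom U (up_ring.coeff U w 0) 0"
    using U.deg_zero_impl_monom w by blast
  moreover have "up_ring.coeff U w 0 \<in> S"
    using U.coeff_closed[OF w(1)] by simp
  ultimately have "ev w \<in> S"
    by (metis ev_const)
  with w t show ?thesis
    by blast
qed

text \<open>If \<open>x\<close> is transcendental over \<open>S\<close>, take for \<open>u\<close>
  the leading coefficient of the polynomial representing \<open>v\<close>: its image under
  \<open>h\<close> is a nonzero polynomial, and \<open>x\<close> is sent to a non-root of it. If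
  \<open>x\<close> is algebraic, let \<open>P\<close> have minimal degree in the kernel of
  \<open>ev\<close>, with leading coefficient \<open>l\<close>, and take
  \<open>u = l \<otimes> u0\<close> with \<open>u0\<close> a multiple of \<open>v\<close> in
  \<open>S\<close>: the image of \<open>P\<close> keeps its degree, \<open>x\<close> is sent to a
  root of it, and \<open>h u0 \<noteq> 0\<close> forces a nonzero value at \<open>v\<close>.\<close>

lemma ex_hom_extension:
  assumes "algebraically_closed F" and v: "v \<in> adj" "v \<noteq> \<zero>"
  shows "\<exists>u\<in>S. u \<noteq> \<zero> \<and> (\<forall>h\<in>ring_hom R0 F. h u \<noteq> \<zero>\<^bsub>F\<^esub> \<longrightarrow>
    (\<exists>h'\<in>ring_hom (D\<lparr>carrier := adj\<rparr>) F. h' v \<noteq> \<zero>\<^bsub>F\<^esub> \<and> (\<forall>s\<in>S. h' s = h s)))"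
proof -
  interpret F: algebraically_closed F by fact
  show ?thesis
  proof (cases "\<exists>p\<in>carrier U. ev p = \<zero> \<and> p \<noteq> \<zero>\<^bsub>U\<^esub>")
    case False
    obtain p where p: "p \<in> carrier U" "ev p = v"
      using v by auto
    let ?u = "U.lcoeff p"
    have "p \<noteq> \<zero>\<^bsub>U\<^esub>"
      using p v by auto
    then have u: "?u \<noteq> \<zero>" "?u \<in> S"
      using p U.lcoeff_nonzero[of p] U.coeff_closed[of p] by auto
    have "\<exists>h'\<in>ring_hom (D\<lparr>carrier := adj\<rparr>) F. h' v \<noteq> \<zero>\<^bsub>F\<^esub> \<and> (\<forall>s\<in>S. h' s = h s)"
      if h: "h \<in> ring_hom R0 F" "h ?u \<noteq> \<zero>\<^bsub>F\<^esub>" for h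
    proof -
      interpret h: UP_pre_univ_prop R0 F h U
        using h by unfold_locales
      obtain a where a: "a \<in> carrier F"
        "(\<Oplus>\<^bsub>F\<^esub>i\<in>{..deg R0 p}. h (up_ring.coeff U p i) \<otimes>\<^bsub>F\<^esub> a [^]\<^bsub>F\<^esub> i) \<noteq> \<zero>\<^bsub>F\<^esub>"
        using F.ex_nonroot[of "\<lambda>i. h (up_ring.coeff U p i)" "deg R0 p"] h h.hom_closed U.coeff_closed[OF p(1)] by blast
      have *: "UnivPoly.eval R0 F h a q = \<zero>\<^bsub>F\<^esub>" if "q \<in> carrier U" "ev q = \<zero>" for q
        using False that ring_hom_zero[OF h.eval_ring_hom[OF a(1)] U.P.ring_axioms F.ring_axioms] by auto
      obtain h' where "h' \<in> ring_hom (D\<lparr>carrier := adj\<rparr>) F"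
        and "\<And>q. q \<in> carrier U \<Longrightarrow> h' (ev q) = UnivPoly.eval R0 F h a q"
        and "\<And>s. s \<in> S \<Longrightarrow> h' s = h s"
        using ex_hom_adj[OF F.is_cring h(1) a(1) *] by blast
      moreover have "UnivPoly.eval R0 F h a p \<noteq> \<zero>\<^bsub>F\<^esub>"
        using a(2) U.eval_on_carrier[OF p(1), of F h a] by simp
      ultimately show ?thesis
        using p by (intro bexI[of _ h']) auto
    qed
    with u show ?thesis
      by blast
  next
    case True
    define null where "null p \<longleftrightarrow> p \<in> carrier U \<and> ev p = \<zero> \<and> p \<noteq> \<zero>\<^bsub>U\<^esub>" for p
    from True obtain p0 where "null p0"
      by (auto simp: null_def)
    then obtain P where "null P" and "\<And>p. null p \<Longrightarrow> deg R0 P \<le> deg R0 p"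
      using ex_has_least_nat[of null p0 "deg R0"] by blast
    then have P: "P \<in> carrier U" "ev P = \<zero>" "P \<noteq> \<zero>\<^bsub>U\<^esub>"
      and min: "\<And>p. p \<in> carrier U \<Longrightarrow> ev p = \<zero> \<Longrightarrow> p \<noteq> \<zero>\<^bsub>U\<^esub> \<Longrightarrow> deg R0 P \<le> deg R0 p"
      by (auto simp: null_def)
    obtain u0 t where u0: "u0 \<in> S" "u0 \<noteq> \<zero>" and t: "t \<in> adj" "u0 = t \<otimes> v"
      using algebraic_multiple[OF P(1,3,2) min v] by blast
    define l where "l = U.lcoeff P"
    have l: "l \<in> S" "l \<noteq> \<zero>"
      using P U.lcoeff_nonzero[of P] U.coeff_closed[of P] by (auto simp: l_def)
    have "deg R0 P \<noteq> 0"
    proof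
      assume "deg R0 P = 0"
      then have "P = UnivPoly.monom U l 0"
        using U.deg_zero_impl_monom[OF P(1)] by (simp add: l_def)
      with P l show False
        by (metis ev_const)
    qed
    have "\<exists>h'\<in>ring_hom (D\<lparr>carrier := adj\<rparr>) F. h' v \<noteq> \<zero>\<^bsub>F\<^esub> \<and> (\<forall>s\<in>S. h' s = h s)"
      if h: "h \<in> ring_hom R0 F" "h (l \<otimes> u0) \<noteq> \<zero>\<^bsub>F\<^esub>" for h
    proof -
      interpret h: UP_pre_univ_prop R0 F h U
        using h by unfold_locales
      have "h (l \<otimes> u0) = h l \<otimes>\<^bsub>F\<^esub> h u0"
        using h.hom_mult[of l u0] l u0 by simp
      moreover have hc: "h l \<in> carrier F" "h u0 \<in> carrier F"
        using l u0 h.hom_closed by auto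
      ultimately have h0: "h l \<noteq> \<zero>\<^bsub>F\<^esub>" "h u0 \<noteq> \<zero>\<^bsub>F\<^esub>"
        using h(2) by auto
      obtain a where a: "a \<in> carrier F"
        "(\<Oplus>\<^bsub>F\<^esub>i\<in>{..deg R0 P}. h (up_ring.coeff U P i) \<otimes>\<^bsub>F\<^esub> a [^]\<^bsub>F\<^esub> i) = \<zero>\<^bsub>F\<^esub>"
        using F.ex_root[of "\<lambda>i. h (up_ring.coeff U P i)" "deg R0 P"] h0 h.hom_closed U.coeff_closed[OF P(1)]
          \<open>deg R0 P \<noteq> 0\<close> unfolding l_def by blast
      let ?g = "UnivPoly.eval R0 F h a"
      interpret g: ring_hom_cring U F ?g
        using h.eval_ring_hom[OF a(1)] U.P.cring_axioms F.is_cring by (intro ring_hom_cringI)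
      have gP: "?g P = \<zero>\<^bsub>F\<^esub>"
        using a U.eval_on_carrier[OF P(1), of F h a] by simp
      \<comment> \<open>Up to the factor \<open>b\<close>, such an \<open>f\<close> is a multiple of
        \<open>P\<close>, because the remainder has value zero and smaller degree. As
        \<open>h b\<close> is a power of \<open>h l\<close>, it is nonzero and can be
        cancelled.\<close>
      have *: "?g f = \<zero>\<^bsub>F\<^esub>" if f: "f \<in> carrier U" "ev f = \<zero>" for f
      proof -
        obtain b q r and k :: nat where b: "b = U.lcoeff P [^]\<^bsub>R0\<^esub> k" "b \<in> S" "b \<noteq> \<zero>"
          and qr: "q \<in> carrier U" "r \<in> carrier U"
          and eq: "b \<odot>\<^bsub>U\<^esub> f = P \<otimes>\<^bsub>U\<^esub> q \<oplus>\<^bsub>U\<^esub> r" "b \<otimes> ev f = ev P \<otimes> ev q \<oplus> ev r"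
          and deg: "r = \<zero>\<^bsub>U\<^esub> \<or> deg R0 r < deg R0 P"
          using ev_long_div[OF P(1,3) f(1)] by metis
        have bD: "b \<in> carrier D"
          using b subringE(1)[OF subring] by auto
        then have "ev r = \<zero>"
          using eq(2) P f qr by simp
        then have "r = \<zero>\<^bsub>U\<^esub>"
          using min[OF qr(2)] deg by fastforce
        then have "?g (b \<odot>\<^bsub>U\<^esub> f) = \<zero>\<^bsub>F\<^esub>"
          using eq(1) P qr gP by simp
        then have "h b \<otimes>\<^bsub>F\<^esub> ?g f = \<zero>\<^bsub>F\<^esub>"
          using h.eval_smult[OF a(1), of b f] b f by simp
        moreover have "h b = h l [^]\<^bsub>F\<^esub> k"
          unfolding b(1) l_def using U.lcoeff_closed[OF P(1)] by (rule h.hom_pow)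
        moreover have "h l [^]\<^bsub>F\<^esub> j \<noteq> \<zero>\<^bsub>F\<^esub>" for j :: nat
          using h0 hc F.integral by (induction j) auto
        ultimately show "?g f = \<zero>\<^bsub>F\<^esub>"
          using F.integral[of "h b" "?g f"] hc f by (metis F.nat_pow_closed g.hom_closed)
      qed
      obtain h' where h': "h' \<in> ring_hom (D\<lparr>carrier := adj\<rparr>) F" "\<And>s. s \<in> S \<Longrightarrow> h' s = h s"
        using ex_hom_adj[OF F.is_cring h(1) a(1) *] by blast
      have "h u0 = h' t \<otimes>\<^bsub>F\<^esub> h' v"
        using h'(2)[OF u0(1)] ring_hom_mult[OF h'(1), of t v] t v by simp
      moreover have "h' t \<in> carrier F"
        using ring_hom_closed[OF h'(1), of t] t by simp
      ultimately have "h' v \<noteq> \<zero>\<^bsub>F\<^esub>"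
        using h0 by auto
      with h' show ?thesis
        by blast
    qed
    moreover have "l \<otimes> u0 \<in> S" "l \<otimes> u0 \<noteq> \<zero>"
      using l u0 subringE(6)[OF subring] subringE(1)[OF subring] integral[of l u0] by auto
    ultimately show ?thesis
      by blast
  qed
qed

end

lemma (in adjoin_element) subring_adj: "subring adj D" "S \<subseteq> adj" "x \<in> adj"
proof -
  show "subring adj D"
    using ring_hom_ring.img_is_subring[OF ring_hom_ringI2[OF U.P.ring_axioms ring_axioms ev.homh] U.P.carrier_is_subring] .
  show "S \<subseteq> adj"
  proof
    fix s assume "s \<in> S"
    then show "s \<in> adj"
      using ev_const[of s] by (intro image_eqI[of _ _ "UnivPoly.monom U s 0"]) auto
  qed
  have "ev (UnivPoly.monom U \<one> 1) = x"
    using id.eval_monom1[OF x_closed] by simp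
  then show "x \<in> adj"
    using subringE(3)[OF subring] by (intro image_eqI[of _ _ "UnivPoly.monom U \<one> 1"]) auto
qed

section \<open>Homomorphisms on finitely generated domains\<close>

text \<open>Induction on the generators. Non-vanishing at \<open>v\<close> in the larger ring is
  reduced to non-vanishing at some \<open>u\<close> in the smaller one; as \<open>u\<close> is not
  known beforehand, the claim is about all nonzero \<open>v\<close>.\<close>

lemma ex_hom_finitely_generated:
  assumes "domain D" and "algebraically_closed F" and K: "subring K D"
    and h0: "h0 \<in> ring_hom (D\<lparr>carrier := K\<rparr>) F"
    and inj: "\<forall>k\<in>K. k \<noteq> \<zero>\<^bsub>D\<^esub> \<longrightarrow> h0 k \<noteq> \<zero>\<^bsub>F\<^esub>"
    and "finite G" and "G \<subseteq> carrier D"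
  shows "\<exists>S. subring S D \<and> K \<subseteq> S \<and> G \<subseteq> S \<and>
    (\<forall>v\<in>S. v \<noteq> \<zero>\<^bsub>D\<^esub> \<longrightarrow> (\<exists>h\<in>ring_hom (D\<lparr>carrier := S\<rparr>) F. h v \<noteq> \<zero>\<^bsub>F\<^esub> \<and> (\<forall>k\<in>K. h k = h0 k)))"
  using \<open>finite G\<close> \<open>G \<subseteq> carrier D\<close>
proof (induction G rule: finite_induct)
  case empty
  show ?case
    using K h0 inj by (intro exI[of _ K]) auto
next
  case (insert x G)
  then obtain S where S: "subring S D" "K \<subseteq> S" "G \<subseteq> S"
    and hom: "\<And>v. v \<in> S \<Longrightarrow> v \<noteq> \<zero>\<^bsub>D\<^esub> \<Longrightarrow>
      \<exists>h\<in>ring_hom (D\<lparr>carrier := S\<rparr>) F. h v \<noteq> \<zero>\<^bsub>F\<^esub> \<and> (\<forall>k\<in>K. h k = h0 k)"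
    by auto
  interpret adjoin_element D S x
    using \<open>domain D\<close> S(1) insert.prems by (simp add: adjoin_element_def adjoin_element_axioms_def)
  have "\<exists>h\<in>ring_hom (D\<lparr>carrier := adj\<rparr>) F. h v \<noteq> \<zero>\<^bsub>F\<^esub> \<and> (\<forall>k\<in>K. h k = h0 k)"
    if v: "v \<in> adj" "v \<noteq> \<zero>\<^bsub>D\<^esub>" for v
  proof -
    obtain u where u: "u \<in> S" "u \<noteq> \<zero>\<^bsub>D\<^esub>"
      and ext: "\<And>h. h \<in> ring_hom R0 F \<Longrightarrow> h u \<noteq> \<zero>\<^bsub>F\<^esub> \<Longrightarrow>
        \<exists>h'\<in>ring_hom (D\<lparr>carrier := adj\<rparr>) F. h' v \<noteq> \<zero>\<^bsub>F\<^esub> \<and> (\<forall>s\<in>S. h' s = h s)"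
      using ex_hom_extension[OF \<open>algebraically_closed F\<close> v] by blast
    obtain h where h: "h \<in> ring_hom R0 F" "h u \<noteq> \<zero>\<^bsub>F\<^esub>" "\<And>k. k \<in> K \<Longrightarrow> h k = h0 k"
      using hom[OF u] by blast
    obtain h' where h': "h' \<in> ring_hom (D\<lparr>carrier := adj\<rparr>) F" "h' v \<noteq> \<zero>\<^bsub>F\<^esub>"
      "\<And>s. s \<in> S \<Longrightarrow> h' s = h s"
      using ext[OF h(1,2)] by blast
    have "\<forall>k\<in>K. h' k = h0 k"
      using h'(3) h(3) S(2) by auto
    with h' show ?thesis
      by blast
  qed
  moreover have "K \<subseteq> adj" "insert x G \<subseteq> adj"
    using S subring_adj by auto
  ultimately show ?case
    using subring_adj(1) by (intro exI[of _ adj]) blast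
qed

section \<open>Hilbert's Nullstellensatz\<close>

text \<open>By Zorn's lemma there is an ideal maximal among those that contain \<open>J\<close> and
  no power of \<open>g\<close>; such an ideal is prime.\<close>

lemma (in cring) ex_primeideal_avoiding_powers:
  assumes J: "ideal J R" and g: "g \<in> carrier R" and pow: "\<And>k::nat. g [^] k \<notin> J"
  obtains P where "primeideal P R" and "J \<subseteq> P" and "g \<notin> P"
proof -
  define A where "A = {I. ideal I R \<and> J \<subseteq> I \<and> (\<forall>k::nat. g [^] k \<notin> I)}"
  have "\<exists>M\<in>A. \<forall>G\<in>A. M \<subseteq> G \<longrightarrow> G = M"
  proof (rule subset_Zorn_nonempty)
    show "A \<noteq> {}"
      using J pow by (auto simp: A_def)
    fix C assume C: "C \<noteq> {}" "subset.chain A C"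
    then have "subset.chain {I. ideal I R} C"
      by (auto simp: A_def subset_chain_def)
    then have "ideal (\<Union>C) R"
      using chain_Union_is_ideal[of C] C by simp
    then show "\<Union>C \<in> A"
      using C by (auto simp: A_def subset_chain_def)
  qed
  then obtain M where "M \<in> A" and max: "\<And>G. G \<in> A \<Longrightarrow> M \<subseteq> G \<Longrightarrow> G = M"
    by blast
  then have M: "ideal M R" "J \<subseteq> M" and pow: "\<And>k::nat. g [^] k \<notin> M"
    by (auto simp: A_def)
  interpret M: ideal M R by fact
  \<comment> \<open>Adding \<open>a\<close> to \<open>M\<close> gives a strictly larger ideal, which
    by maximality contains a power of \<open>g\<close>.\<close>
  have ex: "\<exists>k::nat. \<exists>m\<in>M. \<exists>r\<in>carrier R. g [^] k = m \<oplus> r \<otimes> a" if a: "a \<in> carrier R" "a \<notin> M" for a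
  proof -
    let ?G = "set_add R M (PIdl a)"
    have I: "ideal ?G R"
      using add_ideals[OF M(1) cgenideal_ideal[OF a(1)]] .
    have sub: "M \<subseteq> ?G"
    proof
      fix m assume "m \<in> M"
      then show "m \<in> ?G"
        using a(1) unfolding set_add_def' cgenideal_def
        by (auto intro!: bexI[of _ m] exI[of _ \<zero>])
    qed
    have "a = \<zero> \<oplus> \<one> \<otimes> a"
      using a(1) by simp
    then have "a \<in> ?G"
      using M.zero_closed one_closed unfolding set_add_def' cgenideal_def by blast
    with max[OF _ sub] a I M sub have "\<exists>k::nat. g [^] k \<in> ?G"
      unfolding A_def by blast
    then show ?thesis
      unfolding set_add_def' cgenideal_def by blast
  qed
  have "primeideal M R"
  proof (rule primeidealI[OF M(1) is_cring])
    \<comment> \<open>The exponent 0 yields \<open>\<one> \<notin> M\<close>.\<close>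
    show "carrier R \<noteq> M"
      using pow[of 0] by auto
    fix a b assume ab: "a \<in> carrier R" "b \<in> carrier R" "a \<otimes> b \<in> M"
    show "a \<in> M \<or> b \<in> M"
    proof (rule ccontr)
      assume "\<not> (a \<in> M \<or> b \<in> M)"
      then obtain k l :: nat and m r m' r' where *: "m \<in> M" "r \<in> carrier R" "g [^] k = m \<oplus> r \<otimes> a"
        "m' \<in> M" "r' \<in> carrier R" "g [^] l = m' \<oplus> r' \<otimes> b"
        using ex[of a] ex[of b] ab by blast
      have c: "m \<in> carrier R" "m' \<in> carrier R"
        using * M.Icarr by auto
      have "g [^] (k + l) = (m \<oplus> r \<otimes> a) \<otimes> (m' \<oplus> r' \<otimes> b)"
        using * g by (simp flip: nat_pow_mult)
      \<comment> \<open>After expansion every summand has a factor \<open>m\<close>,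
        \<open>m'\<close> or \<open>a \<otimes> b\<close>, all of which lie in
        \<open>M\<close>.\<close>
      also have "\<dots> = (m' \<oplus> r' \<otimes> b) \<otimes> m \<oplus> ((r \<otimes> a) \<otimes> m' \<oplus> (r \<otimes> r') \<otimes> (a \<otimes> b))"
        using c * ab by (simp add: l_distr r_distr m_ac a_ac)
      also have "\<dots> \<in> M"
        using c * ab by (simp add: M.a_closed M.I_l_closed)
      finally show False
        using pow by blast
    qed
  qed
  moreover have "g \<notin> M"
    using pow[of 1] g by simp
  ultimately show thesis
    using that M by blast
qed

text \<open>A homomorphism to \<open>K\<close> fixing \<open>K\<close> plays the role of a point,
  with its values at the generators as coordinates. The assumption \<open>gen\<close> says that
  \<open>G\<close> generates the ring over \<open>K\<close>.\<close>

theorem (in cring) nullstellensatz_hom: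
  assumes K: "subfield K R" and "algebraically_closed (R\<lparr>carrier := K\<rparr>)"
    and G: "finite G" "G \<subseteq> carrier R"
    and gen: "\<And>S. subring S R \<Longrightarrow> K \<subseteq> S \<Longrightarrow> G \<subseteq> S \<Longrightarrow> carrier R \<subseteq> S"
    and J: "ideal J R" and g: "g \<in> carrier R" and pow: "\<And>k::nat. g [^] k \<notin> J"
  obtains h where "h \<in> ring_hom R (R\<lparr>carrier := K\<rparr>)" and "\<And>k. k \<in> K \<Longrightarrow> h k = k"
    and "\<And>j. j \<in> J \<Longrightarrow> h j = \<zero>" and "h g \<noteq> \<zero>"
proof -
  let ?F = "R\<lparr>carrier := K\<rparr>"
  interpret F: algebraically_closed ?F by fact
  obtain P where P: "primeideal P R" "J \<subseteq> P" "g \<notin> P"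
    using ex_primeideal_avoiding_powers[OF J g pow] by blast
  interpret P: primeideal P R by fact
  define D where "D = R Quot P"
  define \<pi> where "\<pi> = (\<lambda>a. P +> a)"
  interpret D: domain D
    unfolding D_def by (rule P.quotient_is_domain)
  interpret \<pi>: ring_hom_cring R D \<pi>
    using P.rcos_ring_hom_cring by (simp add: D_def \<pi>_def)
  have ker: "\<pi> a = \<zero>\<^bsub>D\<^esub> \<longleftrightarrow> a \<in> P" if "a \<in> carrier R" for a
    using that P.rcos_const_imp_mem[of a] a_rcos_zero[OF P.is_ideal, of a] by (auto simp: D_def \<pi>_def FactRing_def)
  have KR: "K \<subseteq> carrier R"
    using subfieldE(3)[OF K] .
  have KP: "k = \<zero>" if "k \<in> K" "k \<in> P" for k
  proof (rule ccontr)
    assume "k \<noteq> \<zero>"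
    then have "k \<in> Units ?F"
      using F.field_Units that by auto
    then obtain k' where "k' \<in> K" "k \<otimes> k' = \<one>"
      unfolding Units_def by auto
    then have "\<one> \<in> P"
      using P.I_r_closed[OF that(2), of k'] KR by auto
    then show False
      using P.one_imp_carrier P.I_notcarr by auto
  qed
  have incl: "id \<in> ring_hom ?F R"
    using KR by (intro ring_hom_memI) auto
  have "\<pi> \<in> ring_hom ?F D"
    using ring_hom_trans[OF incl \<pi>.homh] by simp
  \<comment> \<open>\<open>K\<close> meets \<open>P\<close> only in zero, so it embeds into the
    quotient; \<open>h0\<close> is the inverse of this embedding.\<close>
  then obtain h0 where h0: "h0 \<in> ring_hom (D\<lparr>carrier := \<pi> ` carrier ?F\<rparr>) ?F"
    "\<And>k. k \<in> carrier ?F \<Longrightarrow> h0 (\<pi> k) = id k"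
    using ring_hom_factor_image[OF F.ring_axioms D.ring_axioms F.ring_axioms, of \<pi> id] ker KP KR
    by (auto simp: ring_hom_def subset_iff)
  have sub: "subring (\<pi> ` K) D"
    using ring_hom_ring.img_is_subring[OF ring_hom_ringI2[OF ring_axioms D.ring_axioms \<pi>.homh] subfieldE(1)[OF K]] .
  have nz: "\<forall>k\<in>\<pi> ` K. k \<noteq> \<zero>\<^bsub>D\<^esub> \<longrightarrow> h0 k \<noteq> \<zero>\<^bsub>?F\<^esub>"
    using h0(2) KR \<pi>.hom_zero by auto
  have \<pi>G: "finite (\<pi> ` G)" "\<pi> ` G \<subseteq> carrier D"
    using G by auto
  have h0': "h0 \<in> ring_hom (D\<lparr>carrier := \<pi> ` K\<rparr>) ?F"
    using h0(1) by simp
  obtain S where S: "subring S D" "\<pi> ` K \<subseteq> S" "\<pi> ` G \<subseteq> S"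
    and hom: "\<forall>v\<in>S. v \<noteq> \<zero>\<^bsub>D\<^esub> \<longrightarrow>
      (\<exists>h\<in>ring_hom (D\<lparr>carrier := S\<rparr>) ?F. h v \<noteq> \<zero>\<^bsub>?F\<^esub> \<and> (\<forall>k\<in>\<pi> ` K. h k = h0 k))"
    using ex_hom_finitely_generated[OF D.domain_axioms F.algebraically_closed_axioms sub h0' nz \<pi>G]
    by (elim exE conjE) (rule that)
  \<comment> \<open>The elements whose class lies in \<open>S\<close> form a subring containing
    \<open>K\<close> and \<open>G\<close>, so \<open>gen\<close> shows that \<open>S\<close>
    contains every class.\<close>
  have "carrier R \<subseteq> {a \<in> carrier R. \<pi> a \<in> S}"
    using S G KR subringE[OF S(1)] by (intro gen subringI) auto
  then have \<pi>S: "\<pi> a \<in> S" if "a \<in> carrier R" for a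
    using that by auto
  obtain h where h: "h \<in> ring_hom (D\<lparr>carrier := S\<rparr>) ?F" "h (\<pi> g) \<noteq> \<zero>" "\<And>k. k \<in> K \<Longrightarrow> h (\<pi> k) = h0 (\<pi> k)"
    using hom[rule_format, OF \<pi>S[OF g]] ker[OF g] P by auto
  have "\<pi> \<in> ring_hom R (D\<lparr>carrier := S\<rparr>)"
    using \<pi>S by (intro ring_hom_memI) auto
  then have "h \<circ> \<pi> \<in> ring_hom R ?F"
    using h(1) by (rule ring_hom_trans)
  moreover have "h (\<pi> j) = \<zero>" if "j \<in> J" for j
  proof -
    have "\<pi> j = \<zero>\<^bsub>D\<^esub>"
      using that P(2) ideal.Icarr[OF J that] ker[of j] by blast
    moreover have "h \<zero>\<^bsub>D\<^esub> = \<zero>"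
      using ring_hom_zero[OF h(1) D.subring_is_ring[OF S(1)] F.ring_axioms] by simp
    ultimately show ?thesis
      by simp
  qed
  ultimately show thesis
    using h(2,3) h0(2) by (intro that[of "h \<circ> \<pi>"]) auto
qed

section \<open>Linear combinations of monomials, the center and prime ideals in a noncommutative
  ring\<close>

context ring begin

lemma mon_mem:
  assumes S: "S \<subseteq> carrier R" "\<one> \<in> S" "\<And>a b. a \<in> S \<Longrightarrow> b \<in> S \<Longrightarrow> a \<otimes> b \<in> S"
    and x: "\<And>i. i < n \<Longrightarrow> x i \<in> S"
  shows "mon R x n \<alpha> \<in> S"
proof -
  have pow: "a [^] (k::nat) \<in> S" if "a \<in> S" for a k
    using that S by (induction k) auto
  have "foldr (\<lambda>i acc. (x i [^] \<alpha> i) \<otimes> acc) is \<one> \<in> S" if "set is \<subseteq> {..<n}" for "is" :: "nat list"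
    using that by (induction "is") (auto intro!: S pow x)
  from this[of "[0..<n]"] show ?thesis
    by (simp add: mon_def atLeast0LessThan)
qed

text \<open>Serves as an induction principle: if every element is such a combination, then a
  property that is stable under sums and products and holds on \<open>K\<close> and for the
  \<open>x i\<close> holds everywhere.\<close>

lemma lin_comb_mem:
  assumes S: "S \<subseteq> carrier R" "\<zero> \<in> S" "\<one> \<in> S" "\<And>a b. a \<in> S \<Longrightarrow> b \<in> S \<Longrightarrow> a \<otimes> b \<in> S"
      "\<And>a b. a \<in> S \<Longrightarrow> b \<in> S \<Longrightarrow> a \<oplus> b \<in> S"
    and x: "\<And>i. i < n \<Longrightarrow> x i \<in> S" and c: "c \<in> coeffs R K n" and K: "K \<subseteq> S"
  shows "lin_comb R x n c \<in> S"
proof -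
  have f: "c \<alpha> \<otimes> mon R x n \<alpha> \<in> S" for \<alpha>
    using c K by (intro S mon_mem x) (auto simp: coeffs_def)
  have "(\<Oplus>\<alpha>\<in>B. c \<alpha> \<otimes> mon R x n \<alpha>) \<in> S" if "finite B" for B
    using that
  proof (induction B rule: finite_induct)
    case (insert \<alpha> B)
    then show ?case
      using f S by (subst finsum_insert) auto
  next
    case empty
    show ?case
      using S by simp
  qed
  then show ?thesis
    using c by (simp add: lin_comb_def coeffs_def)
qed

text \<open>Inserting \<open>c \<otimes> b\<close> keeps the order of the factors; this makes
  congruence modulo a two-sided ideal compatible with products.\<close>

lemma mult_minus_mult:
  assumes "a \<in> carrier R" "b \<in> carrier R" "c \<in> carrier R" "d \<in> carrier R"
  shows "a \<otimes> b \<ominus> c \<otimes> d = (a \<ominus> c) \<otimes> b \<oplus> c \<otimes> (b \<ominus> d)"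
  using assms by (simp add: minus_eq l_distr r_distr l_minus r_minus a_assoc r_neg1)

lemma center_commutes: "a \<in> ring_center R \<Longrightarrow> b \<in> carrier R \<Longrightarrow> a \<otimes> b = b \<otimes> a"
  by (simp add: ring_center_def)

lemma center_closed: "a \<in> ring_center R \<Longrightarrow> a \<in> carrier R"
  by (simp add: ring_center_def)

lemma ring_centerI:
  "a \<in> carrier R \<Longrightarrow> (\<And>b. b \<in> carrier R \<Longrightarrow> a \<otimes> b = b \<otimes> a) \<Longrightarrow> a \<in> ring_center R"
  by (simp add: ring_center_def)

lemma ring_center_subring: "subring (ring_center R) R"
proof (rule subringI)
  show "ring_center R \<subseteq> carrier R" "\<one> \<in> ring_center R"
    by (auto simp: ring_center_def)
  show "\<ominus> h \<in> ring_center R" if "h \<in> ring_center R" for h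
    using that center_commutes[OF that] center_closed[OF that]
    by (intro ring_centerI) (simp_all add: l_minus r_minus)
  fix h1 h2 assume h: "h1 \<in> ring_center R" "h2 \<in> ring_center R"
  note hc = h[THEN center_closed]
  show "h1 \<oplus> h2 \<in> ring_center R"
    using hc h[THEN center_commutes] by (intro ring_centerI) (simp_all add: l_distr r_distr)
  show "h1 \<otimes> h2 \<in> ring_center R"
  proof (rule ring_centerI)
    fix b assume b: "b \<in> carrier R"
    have "h1 \<otimes> h2 \<otimes> b = h1 \<otimes> (b \<otimes> h2)"
      unfolding center_commutes[OF h(2) b, symmetric] using hc b by (rule m_assoc)
    also have "\<dots> = b \<otimes> h1 \<otimes> h2"
      unfolding center_commutes[OF h(1) b, symmetric] using hc b by (simp add: m_assoc)
    also have "\<dots> = b \<otimes> (h1 \<otimes> h2)"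
      using hc b by (simp add: m_assoc)
    finally show "h1 \<otimes> h2 \<otimes> b = b \<otimes> (h1 \<otimes> h2)" .
  qed (use hc in simp)
qed

text \<open>The principal left ideals \<open>L a\<close> and \<open>L b\<close> have their product
  in \<open>P\<close>, because the central element \<open>a\<close> can be moved past
  \<open>s\<close> in the product of \<open>r \<otimes> a\<close> and
  \<open>s \<otimes> b\<close>.\<close>

lemma prime_ideal_nc_central:
  assumes P: "prime_ideal_nc P R" and a: "a \<in> ring_center R" and b: "b \<in> ring_center R" and ab: "a \<otimes> b \<in> P"
  shows "a \<in> P \<or> b \<in> P"
proof -
  have "ideal P R"
    using P by (simp add: prime_ideal_nc_def)
  then interpret P: ideal P R .
  note C = center_closed
  define L where "L c = {r \<otimes> c | r. r \<in> carrier R}" for c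
  have self: "c \<in> L c" if "c \<in> carrier R" for c
    using that by (auto simp: L_def intro!: exI[of _ \<one>])
  have left: "left_ideal (L c) R" if c: "c \<in> carrier R" for c
    unfolding left_ideal_def
  proof (intro conjI ballI)
    show "additive_subgroup (L c) R"
    proof (intro additive_subgroup.intro add.subgroupI)
      show "L c \<noteq> {}"
        using self[OF c] by blast
      show "\<ominus> d \<in> L c" if "d \<in> L c" for d
        using that c by (auto simp: L_def simp flip: l_minus)
      show "d \<oplus> e \<in> L c" if "d \<in> L c" "e \<in> L c" for d e
        using that c by (auto simp: L_def simp flip: l_distr)
      show "L c \<subseteq> carrier R"
        using c by (auto simp: L_def)
    qed
    show "d \<otimes> e \<in> L c" if "d \<in> carrier R" "e \<in> L c" for d e
      using that c by (auto simp: L_def simp flip: m_assoc)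
  qed
  have "(r \<otimes> a) \<otimes> (s \<otimes> b) \<in> P" if "r \<in> carrier R" "s \<in> carrier R" for r s
  proof -
    have "(r \<otimes> a) \<otimes> (s \<otimes> b) = r \<otimes> (a \<otimes> s) \<otimes> b"
      using that C[OF a] C[OF b] by (simp add: m_assoc)
    also have "\<dots> = (r \<otimes> s) \<otimes> (a \<otimes> b)"
      unfolding center_commutes[OF a that(2)] using that C[OF a] C[OF b] by (simp add: m_assoc)
    finally show ?thesis
      using that P.I_l_closed[OF ab] by simp
  qed
  then have "ideal_mult R (L a) (L b) \<subseteq> P"
    unfolding ideal_mult_def using P.additive_subgroup_axioms by (intro Inter_lower) (auto simp: L_def)
  then have "L a \<subseteq> P \<or> L b \<subseteq> P"
    using P left C a b unfolding prime_ideal_nc_def by blast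
  then show ?thesis
    using self C a b by blast
qed

lemma prime_ideal_nc_central_pow:
  assumes P: "prime_ideal_nc P R" and a: "a \<in> ring_center R" and "a [^] (k::nat) \<in> P"
  shows "a \<in> P"
  using assms(3)
proof (induction k)
  case 0
  then show ?case
    using P ideal.one_imp_carrier by (auto simp: prime_ideal_nc_def)
next
  case (Suc k)
  have "a [^] k \<in> ring_center R"
    using a subringE(3,6)[OF ring_center_subring] by (induction k) auto
  with Suc show ?case
    using prime_ideal_nc_central[OF P _ a, of "a [^] k"] by auto
qed

text \<open>If \<open>f\<close> and \<open>g\<close> lie outside \<open>P\<close>, they are
  congruent to nonzero scalars \<open>a\<close> and \<open>b\<close>, so
  \<open>f \<otimes> g \<in> P\<close> would put the unit \<open>a \<otimes> b\<close> into
  \<open>P\<close>. This primeness for elements implies the one for left ideals.\<close>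

lemma prime_ideal_nc_of_complement:
  assumes K: "subfield K R" and P: "ideal P R" "P \<noteq> carrier R"
    and KP: "\<And>f. f \<in> carrier R \<Longrightarrow> \<exists>k\<in>K. f \<ominus> k \<in> P"
  shows "prime_ideal_nc P R"
proof -
  interpret P: ideal P R by fact
  have KR: "K \<subseteq> carrier R"
    using subfieldE(3)[OF K] .
  have prod: "f \<in> P \<or> g \<in> P" if fg: "f \<in> carrier R" "g \<in> carrier R" "f \<otimes> g \<in> P" for f g
  proof (rule ccontr)
    assume "\<not> (f \<in> P \<or> g \<in> P)"
    obtain a b where a: "a \<in> K" "f \<ominus> a \<in> P" and b: "b \<in> K" "g \<ominus> b \<in> P"
      using KP fg by blast
    have C: "a \<in> carrier R" "b \<in> carrier R"
      using a b KR by auto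
    have "a \<noteq> \<zero>" "b \<noteq> \<zero>"
      using a b fg \<open>\<not> (f \<in> P \<or> g \<in> P)\<close> by (auto simp: minus_eq)
    then have ab: "a \<otimes> b \<in> K - {\<zero>}"
      using subfieldE(1,5)[OF K] a b subringE(6) by fastforce
    have "f \<otimes> g \<ominus> a \<otimes> b \<in> P"
      unfolding mult_minus_mult[OF fg(1,2) C]
      using a b C fg by (intro P.a_closed P.I_l_closed P.I_r_closed)
    then have "f \<otimes> g \<ominus> (f \<otimes> g \<ominus> a \<otimes> b) \<in> P"
      using fg(3) unfolding minus_eq[of "f \<otimes> g" "f \<otimes> g \<ominus> a \<otimes> b"] by (intro P.a_closed P.a_inv_closed)
    moreover have "f \<otimes> g \<ominus> (f \<otimes> g \<ominus> a \<otimes> b) = a \<otimes> b"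
      using fg C by (simp add: minus_eq minus_add r_neg2)
    ultimately have "a \<otimes> b \<in> P"
      by simp
    moreover obtain c where "c \<in> K" "c \<otimes> (a \<otimes> b) = \<one>"
      using subfield_m_inv(1,3)[OF K ab] by blast
    ultimately have "\<one> \<in> P"
      using P.I_l_closed KR by (metis subsetD)
    then show False
      using P(2) P.one_imp_carrier by auto
  qed
  have "L \<subseteq> P \<or> M \<subseteq> P" if "left_ideal L R" "left_ideal M R" "ideal_mult R L M \<subseteq> P" for L M
  proof (rule ccontr)
    assume "\<not> (L \<subseteq> P \<or> M \<subseteq> P)"
    then obtain l m where lm: "l \<in> L" "l \<notin> P" "m \<in> M" "m \<notin> P"
      by blast
    have "l \<in> carrier R" "m \<in> carrier R"
      using that lm additive_subgroup.a_Hcarr by (auto simp: left_ideal_def)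
    moreover have "l \<otimes> m \<in> ideal_mult R L M"
      using lm by (auto simp: ideal_mult_def)
    ultimately show False
      using that(3) prod lm by blast
  qed
  then show ?thesis
    using P by (auto simp: prime_ideal_nc_def)
qed

end

section \<open>Ideals of points and the right inclusion\<close>

text \<open>The elements congruent to a scalar include \<open>K\<close> and each \<open>x i\<close>,
  which is congruent to \<open>z i\<close>, and are stable under sums and products; since the
  monomials span \<open>A\<close>, they are all of \<open>A\<close>.\<close>

lemma pt_ideal_prime:
  assumes K: "subfield K A" and A: "skew_PBW A K x n" and z: "z \<in> points A K n"
    and proper: "pt_ideal A x n z \<noteq> carrier A"
  shows "prime_ideal_nc (pt_ideal A x n z) A"
proof -
  from A interpret ring A
    by (simp add: skew_PBW_def)
  have x: "x i \<in> carrier A" if "i < n" for i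
    using A that by (simp add: skew_PBW_def)
  have KA: "K \<subseteq> carrier A"
    using subfieldE(3)[OF K] .
  have zi: "z i \<in> K" if "i < n" for i
    using z that by (simp add: points_def)
  let ?P = "pt_ideal A x n z"
  have gens: "{x i \<ominus>\<^bsub>A\<^esub> z i | i. i < n} \<subseteq> carrier A"
    using x zi KA by auto
  have P: "ideal ?P A"
    unfolding pt_ideal_def by (rule genideal_ideal[OF gens])
  interpret P: ideal ?P A by fact
  define S where "S = {f \<in> carrier A. \<exists>k\<in>K. f \<ominus>\<^bsub>A\<^esub> k \<in> ?P}"
  have KS: "K \<subseteq> S"
    using KA by (auto simp: S_def minus_eq r_neg intro!: bexI)
  have "f \<in> S" if f: "f \<in> carrier A" for f
  proof -
    obtain c where c: "c \<in> coeffs A K n" "f = lin_comb A x n c"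
      using A f unfolding skew_PBW_def bij_betw_def by blast
    have "lin_comb A x n c \<in> S"
    proof (rule lin_comb_mem[OF _ _ _ _ _ _ c(1) KS])
      show "S \<subseteq> carrier A" "\<zero>\<^bsub>A\<^esub> \<in> S" "\<one>\<^bsub>A\<^esub> \<in> S"
        using KS subringE(2,3)[OF subfieldE(1)[OF K]] by (auto simp: S_def)
      show "x i \<in> S" if "i < n" for i
        using genideal_self[OF gens] x zi that unfolding S_def pt_ideal_def by blast
      fix a b assume "a \<in> S" "b \<in> S"
      then obtain k l where a: "a \<in> carrier A" "k \<in> K" "a \<ominus>\<^bsub>A\<^esub> k \<in> ?P"
        and b: "b \<in> carrier A" "l \<in> K" "b \<ominus>\<^bsub>A\<^esub> l \<in> ?P"
        by (auto simp: S_def)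
      have kl: "k \<in> carrier A" "l \<in> carrier A"
        using a b KA by auto
      have "(a \<oplus>\<^bsub>A\<^esub> b) \<ominus>\<^bsub>A\<^esub> (k \<oplus>\<^bsub>A\<^esub> l) = (a \<ominus>\<^bsub>A\<^esub> k) \<oplus>\<^bsub>A\<^esub> (b \<ominus>\<^bsub>A\<^esub> l)"
        using a b kl by (simp add: minus_eq a_ac minus_add)
      also have "\<dots> \<in> ?P"
        using a b by (intro P.a_closed)
      finally have "(a \<oplus>\<^bsub>A\<^esub> b) \<ominus>\<^bsub>A\<^esub> (k \<oplus>\<^bsub>A\<^esub> l) \<in> ?P" .
      moreover have "k \<oplus>\<^bsub>A\<^esub> l \<in> K" "k \<otimes>\<^bsub>A\<^esub> l \<in> K"
        using a b subringE(6,7)[OF subfieldE(1)[OF K]] by auto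
      ultimately show "a \<oplus>\<^bsub>A\<^esub> b \<in> S"
        using a b unfolding S_def by blast
      have "a \<otimes>\<^bsub>A\<^esub> b \<ominus>\<^bsub>A\<^esub> k \<otimes>\<^bsub>A\<^esub> l = (a \<ominus>\<^bsub>A\<^esub> k) \<otimes>\<^bsub>A\<^esub> b \<oplus>\<^bsub>A\<^esub> k \<otimes>\<^bsub>A\<^esub> (b \<ominus>\<^bsub>A\<^esub> l)"
        using a b kl by (intro mult_minus_mult)
      also have "\<dots> \<in> ?P"
        using a b kl by (intro P.a_closed P.I_l_closed P.I_r_closed)
      finally show "a \<otimes>\<^bsub>A\<^esub> b \<in> S"
        using a b \<open>k \<otimes>\<^bsub>A\<^esub> l \<in> K\<close> unfolding S_def by blast
    qed
    with c show ?thesis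
      by simp
  qed
  then show ?thesis
    using proper by (intro prime_ideal_nc_of_complement[OF K P]) (auto simp: S_def)
qed

text \<open>A proper point ideal containing \<open>I\<close> is one of the primes whose intersection
  is the radical; an improper one contains everything. The latter occurs: if two variables commute
  up to a scalar \<open>q \<noteq> 1\<close> and \<open>z\<close> has nonzero coordinates there,
  then a nonzero scalar lies in the ideal.\<close>

lemma radical_subset_Iv:
  assumes K: "subfield K A" and A: "skew_PBW A K x n"
  shows "radical A I \<subseteq> Iv A x n (V A K x n I)"
proof -
  have "g \<in> pt_ideal A x n z" if "g \<in> radical A I" "z \<in> V A K x n I" for g z
  proof (cases "pt_ideal A x n z = carrier A")
    case False
    then show ?thesis
      using that pt_ideal_prime[OF K A _ False] by (auto simp: radical_def V_def)
  next
    case True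
    then show ?thesis
      using that by (simp add: radical_def)
  qed
  then show ?thesis
    by (auto simp: Iv_def radical_def)
qed

section \<open>Evaluation in the center and the left inclusion\<close>

context ring begin

lemma hom_mon:
  assumes S: "subring S R" and h: "h \<in> ring_hom (R\<lparr>carrier := S\<rparr>) (R\<lparr>carrier := T\<rparr>)"
    and x: "\<And>i. i < n \<Longrightarrow> x i \<in> S" and a: "\<And>i. i < n \<Longrightarrow> h (x i) = a i"
  shows "h (mon R x n \<alpha>) = mon R a n \<alpha>"
proof -
  note S' = subringE[OF S]
  have one: "h \<one> = \<one>" and mult: "\<And>u v. u \<in> S \<Longrightarrow> v \<in> S \<Longrightarrow> h (u \<otimes> v) = h u \<otimes> h v"
    using ring_hom_one[OF h] ring_hom_mult[OF h] by auto
  have pow: "u [^] (k::nat) \<in> S \<and> h (u [^] k) = h u [^] k" if "u \<in> S" for u k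
    using that S' one mult by (induction k) auto
  have "foldr (\<lambda>i acc. (x i [^] \<alpha> i) \<otimes> acc) is \<one> \<in> S \<and>
    h (foldr (\<lambda>i acc. (x i [^] \<alpha> i) \<otimes> acc) is \<one>) = foldr (\<lambda>i acc. (a i [^] \<alpha> i) \<otimes> acc) is \<one>"
    if "set is \<subseteq> {..<n}" for "is" :: "nat list"
    using that by (induction "is") (auto simp: one mult pow x a S')
  from this[of "[0..<n]"] show ?thesis
    by (simp add: mon_def atLeast0LessThan)
qed

text \<open>Identifies a homomorphism fixing \<open>K\<close> with evaluation at the point
  \<open>a\<close> formed by the images of the generators.\<close>

lemma hom_lin_comb:
  assumes S: "subring S R" and T: "subring T R"
    and h: "h \<in> ring_hom (R\<lparr>carrier := S\<rparr>) (R\<lparr>carrier := T\<rparr>)"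
    and K: "K \<subseteq> S" and fixK: "\<And>k. k \<in> K \<Longrightarrow> h k = k"
    and x: "\<And>i. i < n \<Longrightarrow> x i \<in> S" and a: "\<And>i. i < n \<Longrightarrow> h (x i) = a i"
    and c: "c \<in> coeffs R K n"
  shows "h (lin_comb R x n c) = lin_comb R a n c"
proof -
  note S' = subringE[OF S]
  have cK: "c \<alpha> \<in> K" for \<alpha>
    using c by (simp add: coeffs_def)
  have monS: "mon R x n \<alpha> \<in> S" for \<alpha>
    using S' x by (intro mon_mem) auto
  have closed: "h u \<in> carrier R" if "u \<in> S" for u
    using ring_hom_closed[OF h] that subringE(1)[OF T] by auto
  have hm: "h (mon R x n \<alpha>) = mon R a n \<alpha>" for \<alpha>
    using x a by (intro hom_mon[OF S h]) auto
  have f: "c \<alpha> \<otimes> mon R x n \<alpha> \<in> S" "h (c \<alpha> \<otimes> mon R x n \<alpha>) = c \<alpha> \<otimes> mon R a n \<alpha>" for \<alpha>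
    using K cK[of \<alpha>] monS[of \<alpha>] S' ring_hom_mult[OF h, of "c \<alpha>" "mon R x n \<alpha>"] fixK hm
    by auto
  \<comment> \<open>Membership in \<open>S\<close> is carried through the induction because
    \<open>h\<close> is additive only on \<open>S\<close>.\<close>
  have sum: "(\<Oplus>\<alpha>\<in>B. c \<alpha> \<otimes> mon R x n \<alpha>) \<in> S \<and>
    h (\<Oplus>\<alpha>\<in>B. c \<alpha> \<otimes> mon R x n \<alpha>) = (\<Oplus>\<alpha>\<in>B. c \<alpha> \<otimes> mon R a n \<alpha>)" if "finite B" for B
    using that
  proof (induction B rule: finite_induct)
    case empty
    have "h \<zero> = \<zero>"
      using ring_hom_zero[OF h subring_is_ring[OF S] subring_is_ring[OF T]] by simp
    then show ?case
      using S' by simp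
  next
    case (insert \<alpha> B)
    have "(\<Oplus>\<alpha>\<in>insert \<alpha> B. c \<alpha> \<otimes> mon R x n \<alpha>) = c \<alpha> \<otimes> mon R x n \<alpha> \<oplus> (\<Oplus>\<alpha>\<in>B. c \<alpha> \<otimes> mon R x n \<alpha>)"
      using insert.hyps f(1) S'(1) by (intro finsum_insert) auto
    moreover have "c \<alpha> \<otimes> mon R a n \<alpha> \<in> carrier R" for \<alpha>
      using f(2)[of \<alpha>] closed[OF f(1)[of \<alpha>]] by simp
    then have "(\<Oplus>\<alpha>\<in>insert \<alpha> B. c \<alpha> \<otimes> mon R a n \<alpha>) = c \<alpha> \<otimes> mon R a n \<alpha> \<oplus> (\<Oplus>\<alpha>\<in>B. c \<alpha> \<otimes> mon R a n \<alpha>)"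
      using insert.hyps by (intro finsum_insert) auto
    moreover have "h (u \<oplus> v) = h u \<oplus> h v" if "u \<in> S" "v \<in> S" for u v
      using ring_hom_add[OF h] that by simp
    ultimately show ?case
      using insert.IH f[of \<alpha>] S'(7) by simp
  qed
  then show ?thesis
    using c by (simp add: lin_comb_def coeffs_def)
qed

text \<open>In a skew extension scalars need not commute with the variables. Here they do, since a
  scalar is a constant polynomial in \<open>y\<close> and all polynomials in \<open>y\<close> are
  central.\<close>

lemma base_subset_center:
  assumes "center_poly_ring R K y n" and K: "subring K R"
  shows "K \<subseteq> ring_center R"
proof
  fix k assume k: "k \<in> K"
  then have kR: "k \<in> carrier R"
    using subringE(1)[OF K] by auto
  define c where "c \<alpha> = (if \<alpha> = (\<lambda>_. 0::nat) then k else \<zero>)" for \<alpha> :: "nat \<Rightarrow> nat"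
  \<comment> \<open>\<open>lin_comb\<close> sums over the support only, and this is empty for
    \<open>k = \<zero>\<close>.\<close>
  have supp: "{\<alpha>. c \<alpha> \<noteq> \<zero>} = (if k = \<zero> then {} else {\<lambda>_. 0})"
    by (auto simp: c_def)
  then have c: "c \<in> coeffs R K n"
    using k subringE(2)[OF K] by (auto simp: coeffs_def c_def exps_def)
  have "foldr (\<lambda>i acc. (y i [^] (0::nat)) \<otimes> acc) is \<one> = \<one>" for "is" :: "nat list"
    by (induction "is") auto
  then have "mon R y n (\<lambda>_. 0) = \<one>"
    by (simp add: mon_def)
  then have "lin_comb R y n c = k"
    unfolding lin_comb_def supp using kR by (auto simp: c_def)
  then show "k \<in> ring_center R"
    using assms(1) c unfolding center_poly_ring_def bij_betw_def by blast
qed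

text \<open>If no power of \<open>g\<close> lies in \<open>I\<close>, the Nullstellensatz in the
  center gives a homomorphism \<open>h\<close> that kills \<open>I \<inter> ring_center R\<close>
  but not \<open>g\<close>; its values at the \<open>y i\<close> are the coordinates of a common
  zero at which \<open>g\<close> does not vanish.\<close>

lemma center_nullstellensatz:
  assumes K: "subfield K R" and closed: "algebraically_closed (R\<lparr>carrier := K\<rparr>)"
    and Z: "center_poly_ring R K y n" and I: "ideal I R"
    and g: "g \<in> IZ R K y n (VZ R K y n (I \<inter> ring_center R))"
  shows "\<exists>k::nat. g [^] k \<in> I"
proof (rule ccontr)
  assume no: "\<nexists>k::nat. g [^] k \<in> I"
  let ?Z = "R\<lparr>carrier := ring_center R\<rparr>"
  note center = subringE[OF ring_center_subring]
  have KZ: "K \<subseteq> ring_center R"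
    using base_subset_center[OF Z subfieldE(1)[OF K]] .
  interpret Z: cring ?Z
    using subcringI[OF ring_center_subring] center_commutes center_closed subcring_iff[OF center(1)] by auto
  have y: "y i \<in> ring_center R" if "i < n" for i
    using Z that by (simp add: center_poly_ring_def)
  have rep: "\<exists>c\<in>coeffs R K n. lin_comb R y n c = f" if "f \<in> ring_center R" for f
    using Z that unfolding center_poly_ring_def bij_betw_def by (metis imageE)
  \<comment> \<open>Algebraic independence of \<open>y\<close> makes the coefficient family unique,
    so the description in \<open>evalZ\<close> returns \<open>c\<close>.\<close>
  have eval: "evalZ R K y n (lin_comb R y n c) a = lin_comb R a n c" if "c \<in> coeffs R K n" for c a
  proof -
    have "(THE d. d \<in> coeffs R K n \<and> lin_comb R y n d = lin_comb R y n c) = c"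
      using that Z by (intro the_equality) (auto simp: center_poly_ring_def bij_betw_def inj_on_def)
    then show ?thesis
      by (simp add: evalZ_def)
  qed
  have gZ: "g \<in> ring_center R"
    using g by (simp add: IZ_def)
  have subf: "subfield K ?Z"
    using subfield_iff(2)[OF K] Z.subfield_iff(1)[of K] KZ by simp
  have J: "ideal (I \<inter> ring_center R) ?Z"
  proof -
    have "id \<in> ring_hom ?Z R"
      using center(1) by (intro ring_hom_memI) auto
    from ring_hom_ring.ideal_vimage[OF ring_hom_ringI2[OF Z.ring_axioms ring_axioms this] I]
    show ?thesis
      by (simp add: Int_def conj_commute)
  qed
  have gen: "carrier ?Z \<subseteq> S" if S: "subring S ?Z" "K \<subseteq> S" "y ` {..<n} \<subseteq> S" for S
  proof
    fix f assume "f \<in> carrier ?Z"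
    then obtain c where c: "c \<in> coeffs R K n" "lin_comb R y n c = f"
      using rep by auto
    have "lin_comb R y n c \<in> S"
      using subringE[OF S(1)] S center(1) c by (intro lin_comb_mem[of S]) auto
    with c show "f \<in> S"
      by simp
  qed
  have pow: "g [^]\<^bsub>?Z\<^esub> k \<notin> I \<inter> ring_center R" for k :: nat
    using no by (auto simp flip: nat_pow_consistent)
  obtain h where h: "h \<in> ring_hom ?Z (R\<lparr>carrier := K\<rparr>)" and hK: "\<And>k. k \<in> K \<Longrightarrow> h k = k"
    and hJ: "\<And>j. j \<in> I \<inter> ring_center R \<Longrightarrow> h j = \<zero>" and hg: "h g \<noteq> \<zero>"
  proof (rule Z.nullstellensatz_hom[OF subf, of "y ` {..<n}" "I \<inter> ring_center R" g])
    show "carrier ?Z \<subseteq> S" if "subring S ?Z" "K \<subseteq> S" "y ` {..<n} \<subseteq> S" for S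
      using that by (rule gen)
  qed (use closed y gZ J pow that in auto)
  \<comment> \<open>The value zero from index \<open>n\<close> on is what \<open>points\<close>
    requires.\<close>
  define a where "a i = (if i < n then h (y i) else \<zero>)" for i
  have "a \<in> points R K n"
    using ring_hom_closed[OF h] y by (auto simp: points_def a_def)
  have ev: "evalZ R K y n f a = h f" if f: "f \<in> ring_center R" for f
  proof -
    obtain c where c: "c \<in> coeffs R K n" "lin_comb R y n c = f"
      using rep[OF f] by blast
    have "h (lin_comb R y n c) = lin_comb R a n c"
      using y by (intro hom_lin_comb[OF ring_center_subring subfieldE(1)[OF K] h KZ hK _ _ c(1)]) (auto simp: a_def)
    with eval[OF c(1), of a] c(2) show ?thesis
      by simp
  qed
  have "a \<in> VZ R K y n (I \<inter> ring_center R)"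
    using \<open>a \<in> points R K n\<close> ev hJ by (auto simp: VZ_def)
  then have "evalZ R K y n g a = \<zero>"
    using g by (simp add: IZ_def)
  then show False
    using hg ev[OF gZ] by simp
qed

end

theorem theorem3p13:
  fixes A :: "('a, 'b) ring_scheme" and K :: "'a set" and x y :: "nat \<Rightarrow> 'a"
    and n :: nat and I :: "'a set"
  assumes "ring A"
    and "subfield K A"
    and "algebraically_closed (A\<lparr>carrier := K\<rparr>)"
    and "skew_PBW A K x n"
    and "quasi_commutative A K x n"
    and "bijective_PBW A K x n"
    and "center_poly_ring A K y n"
    and "ideal I A"
  shows "genideal A (IZ A K y n (VZ A K y n (I \<inter> ring_center A))) \<subseteq> radical A I
       \<and> radical A I \<subseteq> Iv A x n (V A K x n I)"
proof
  interpret ring A by fact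
  let ?G = "IZ A K y n (VZ A K y n (I \<inter> ring_center A))"
  have G: "?G \<subseteq> ring_center A"
    by (auto simp: IZ_def)
  then have "?G \<subseteq> carrier A"
    by (auto simp: ring_center_def)
  \<comment> \<open>It suffices that each prime ideal over \<open>I\<close> contains
    \<open>?G\<close>: elements of \<open>?G\<close> are central and have a power in
    \<open>I\<close>.\<close>
  moreover have "genideal A ?G \<subseteq> P" if P: "prime_ideal_nc P A" "I \<subseteq> P" for P
  proof (rule genideal_minimal)
    show "ideal P A"
      using P by (simp add: prime_ideal_nc_def)
    show "?G \<subseteq> P"
    proof
      fix g assume g: "g \<in> ?G"
      then obtain k :: nat where "g [^]\<^bsub>A\<^esub> k \<in> I"
        using center_nullstellensatz assms by blast
      then show "g \<in> P"
        using prime_ideal_nc_central_pow[OF P(1)] P(2) G g by blast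
    qed
  qed
  ultimately show "genideal A ?G \<subseteq> radical A I"
    using genideal_ideal[of ?G] ideal.Icarr by (fastforce simp: radical_def)
  show "radical A I \<subseteq> Iv A x n (V A K x n I)"
    using radical_subset_Iv assms by blast
qed

end
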